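(* Let $\mathcal X$ be a complete metric space, let $\Phi\colon\mathbb{T}^{m+1}\to\mathcal X$ satisfy a local Hölder condition with exponent $\alpha\in(0,1]$, and let $\omega=(\omega_1,\dots,\omega_m)\in\mathbb{R}^m$ satisfy the Diophantine condition of order $\nu\ge0$ with $\nu(m-1)<1$. Let $\varphi(t)=\Phi(t,\omega_1t,\dots,\omega_mt)$, $t\in\mathbb{R}$ (an almost periodic function). Then $$\mathfrak{Di}(\varphi)\le\frac1\alpha\cdot\frac{(1+\nu)m}{1-\nu(m-1)}.$$
   Context: $\mathbb{T}^{k}=\mathbb{R}^k/\mathbb{Z}^k$ with metric $|\theta_1-\theta_2|_k$, where $|x|_k$ is the Euclidean distance from $x$ to $\mathbb{Z}^k$. A map $\chi\colon\mathcal Y\to\mathcal Z$ between metric spaces satisfies a local Hölder condition with exponent $\alpha\in(0,1]$ if there are $C>0,\varepsilon_0>0$ with $\varrho_{\mathcal Z}(\chi(y_1),\chi(y_2))\le C\varrho_{\mathcal Y}(y_1,y_2)^\alpha$ whenever $\varrho_{\mathcal Y}(y_1,y_2)<\varepsilon_0$. The Diophantine condition of order $\nu$: there is $C_d>0$ with $|\omega q|_m\ge C_d(1/q)^{(1+\nu)/m}$ for all natural $q$. For $\varepsilon>0$, $\mathcal T_\varepsilon(\varphi)$ is the set of $\tau\in\mathbb{R}$ with $\sup_{t\in\mathbb{R}}\varrho_{\mathcal X}(\varphi(t+\tau),\varphi(t))\le\varepsilon$ (a relatively dense set); the inclusion length $l_\varphi(\varepsilon)$ is the infimum of $L>0$ such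 that every interval $[a,a+L]$ meets $\mathcal T_\varepsilon(\varphi)$, and $\mathfrak{Di}(\varphi)=\limsup_{\varepsilon\to0+}\frac{\ln l_\varphi(\varepsilon)}{\ln(1/\varepsilon)}$ (with $\ln(l_\varphi(\varepsilon)+1)$ used if $l_\varphi(\varepsilon)=0$ for small $\varepsilon$). *)

theory Defs
  imports "HOL-Analysis.Analysis"
begin

section \<open>Flat tori\<close>

text \<open>
  The torus of dimension \<open>k\<close> is the quotient of a Euclidean space \<open>'a\<close> with \<open>DIM('a) = k\<close> by its
  standard lattice. On \<^typ>\<open>real \<times> (real ^ 'm)\<close> the library norm is the Euclidean norm of the
  coordinates, so \<open>(real \<times> (real ^ 'm)) torus\<close> is the torus of dimension \<open>CARD('m) + 1\<close>.
\<close>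

definition int_lattice :: "'a::euclidean_space set" where
  "int_lattice = {x. \<forall>b\<in>Basis. x \<bullet> b \<in> \<int>}"

definition lattice_dist :: "'a::euclidean_space \<Rightarrow> real" where
  "lattice_dist x = infdist x int_lattice"

lemma int_lattice_0: "0 \<in> int_lattice"
  by (simp add: int_lattice_def)

lemma int_lattice_add: "x \<in> int_lattice \<Longrightarrow> y \<in> int_lattice \<Longrightarrow> x + y \<in> int_lattice"
  by (simp add: int_lattice_def inner_add_left)

lemma int_lattice_minus: "x \<in> int_lattice \<Longrightarrow> - x \<in> int_lattice"
  by (simp add: int_lattice_def)

lemma int_lattice_diff: "x \<in> int_lattice \<Longrightarrow> y \<in> int_lattice \<Longrightarrow> x - y \<in> int_lattice"
  by (simp add: int_lattice_def inner_diff_left)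

lemma closed_int_lattice: "closed (int_lattice :: 'a::euclidean_space set)"
proof -
  have "int_lattice = (\<Inter>b\<in>Basis. (\<lambda>x::'a. x \<bullet> b) -` \<int>)"
    by (auto simp: int_lattice_def)
  moreover have "closed ((\<lambda>x::'a. x \<bullet> b) -` (\<int> :: real set))" for b
    by (intro continuous_closed_vimage closed_Ints) (auto intro!: continuous_intros)
  ultimately show ?thesis
    by (metis (no_types, lifting) closed_INT)
qed

lemma lattice_dist_eq_0_iff: "lattice_dist x = 0 \<longleftrightarrow> x \<in> int_lattice"
  using in_closed_iff_infdist_zero[OF closed_int_lattice] int_lattice_0
  unfolding lattice_dist_def by blast

lemma lattice_dist_le: "l \<in> int_lattice \<Longrightarrow> lattice_dist x \<le> dist x l"
  unfolding lattice_dist_def by (rule infdist_le)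

lemma lattice_dist_attained:
  obtains l where "l \<in> int_lattice" "lattice_dist x = dist x l"
  using infdist_attains_inf[OF closed_int_lattice, of x] int_lattice_0
  unfolding lattice_dist_def by blast

lemma lattice_dist_minus: "lattice_dist (- x) = lattice_dist x"
proof -
  have "lattice_dist (- y) \<le> lattice_dist y" for y :: 'a
  proof -
    obtain l where l: "l \<in> int_lattice" "lattice_dist y = dist y l"
      by (rule lattice_dist_attained)
    have "lattice_dist (- y) \<le> dist (- y) (- l)"
      by (intro lattice_dist_le int_lattice_minus l)
    then show ?thesis
      using l by (simp add: dist_minus)
  qed
  from this[of x] this[of "- x"] show ?thesis
    by simp
qed

lemma lattice_dist_triangle: "lattice_dist (x + y) \<le> lattice_dist x + lattice_dist y"
proof -
  obtain l where l: "l \<in> int_lattice" "lattice_dist x = dist x l"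
    by (rule lattice_dist_attained)
  obtain k where k: "k \<in> int_lattice" "lattice_dist y = dist y k"
    by (rule lattice_dist_attained)
  have "lattice_dist (x + y) \<le> dist (x + y) (l + k)"
    by (intro lattice_dist_le int_lattice_add l k)
  also have "\<dots> \<le> dist x l + dist y k"
    by (rule dist_triangle_add)
  finally show ?thesis
    using l k by simp
qed

lemma lattice_dist_cong:
  assumes "x - y \<in> int_lattice"
  shows "lattice_dist x = lattice_dist y"
proof -
  have *: "lattice_dist a \<le> lattice_dist b" if "a - b \<in> int_lattice" for a b :: 'a
    using lattice_dist_triangle[of "a - b" b] that lattice_dist_eq_0_iff[of "a - b"] by simp
  show ?thesis
    using *[of x y] *[of y x] assms int_lattice_minus[OF assms] by simp
qed

quotient_type (overloaded) 'a torus =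
  "'a::euclidean_space" / "\<lambda>x y. x - y \<in> int_lattice"
  morphisms rep_torus to_torus
proof (rule equivpI)
  show "reflp (\<lambda>x y::'a. x - y \<in> int_lattice)"
    by (auto intro!: reflpI simp: int_lattice_0)
  show "symp (\<lambda>x y::'a. x - y \<in> int_lattice)"
    using int_lattice_minus by (fastforce intro!: sympI)
  show "transp (\<lambda>x y::'a. x - y \<in> int_lattice)"
    using int_lattice_add by (fastforce intro!: transpI)
qed

instantiation torus :: (euclidean_space) metric_space
begin

lift_definition dist_torus :: "'a torus \<Rightarrow> 'a torus \<Rightarrow> real"
  is "\<lambda>x y. lattice_dist (x - y)"
proof (rule lattice_dist_cong)
  fix x x' y y' :: 'a
  assume "x - x' \<in> int_lattice" "y - y' \<in> int_lattice"
  from int_lattice_diff[OF this] show "x - y - (x' - y') \<in> int_lattice"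
    by (simp add: algebra_simps)
qed

definition uniformity_torus :: "('a torus \<times> 'a torus) filter" where
  "uniformity_torus = (INF e\<in>{0<..}. principal {(x, y). dist x y < e})"

definition open_torus :: "'a torus set \<Rightarrow> bool" where
  "open_torus U \<longleftrightarrow> (\<forall>x\<in>U. eventually (\<lambda>(x', y). x' = x \<longrightarrow> y \<in> U) uniformity)"

instance
proof
  fix x y z :: "'a torus"
  show "dist x y = 0 \<longleftrightarrow> x = y"
    by transfer (rule lattice_dist_eq_0_iff)
  show "dist x y \<le> dist x z + dist y z"
  proof transfer
    fix x y z :: 'a
    show "lattice_dist (x - y) \<le> lattice_dist (x - z) + lattice_dist (y - z)"
      using lattice_dist_triangle[of "x - z" "z - y"] lattice_dist_minus[of "y - z"] by simp
  qed
qed (simp_all add: uniformity_torus_def open_torus_def)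

end

section \<open>Hoelder and Diophantine conditions\<close>

definition local_holder :: "real \<Rightarrow> ('a::metric_space \<Rightarrow> 'b::metric_space) \<Rightarrow> bool" where
  "local_holder \<alpha> f \<longleftrightarrow> (\<exists>C>0. \<exists>\<epsilon>0>0. \<forall>y1 y2.
     dist y1 y2 < \<epsilon>0 \<longrightarrow> dist (f y1) (f y2) \<le> C * dist y1 y2 powr \<alpha>)"

definition diophantine :: "real \<Rightarrow> real ^ 'm \<Rightarrow> bool" where
  "diophantine \<nu> \<omega> \<longleftrightarrow> (\<exists>C>0. \<forall>q::nat. q \<ge> 1 \<longrightarrow>
     lattice_dist (real q *\<^sub>R \<omega>) \<ge> C * (1 / real q) powr ((1 + \<nu>) / real CARD('m)))"

section \<open>Almost periods\<close>

definition almost_periods :: "real \<Rightarrow> (real \<Rightarrow> 'a::metric_space) \<Rightarrow> real set" where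
  "almost_periods \<epsilon> \<phi> = {\<tau>. (SUP t. ereal (dist (\<phi> (t + \<tau>)) (\<phi> t))) \<le> ereal \<epsilon>}"

definition inclusion_lengths :: "real set \<Rightarrow> real set" where
  "inclusion_lengths T = {L. L > 0 \<and> (\<forall>a. {a..a + L} \<inter> T \<noteq> {})}"

definition almost_periodic :: "(real \<Rightarrow> 'a::metric_space) \<Rightarrow> bool" where
  "almost_periodic \<phi> \<longleftrightarrow> continuous_on UNIV \<phi> \<and>
     (\<forall>\<epsilon>>0. inclusion_lengths (almost_periods \<epsilon> \<phi>) \<noteq> {})"

text \<open>
  The infimum below is over a nonempty set, and hence meaningful, when \<open>\<phi>\<close> is almost periodic
  and \<open>\<epsilon> > 0\<close>.
\<close>

definition inclusion_length :: "(real \<Rightarrow> 'a::metric_space) \<Rightarrow> real \<Rightarrow> real" where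
  "inclusion_length \<phi> \<epsilon> = Inf (inclusion_lengths (almost_periods \<epsilon> \<phi>))"

text \<open>
  The inclusion length is nonincreasing in \<open>\<epsilon>\<close>, so for almost periodic \<open>\<phi>\<close> it is either zero for
  all small \<open>\<epsilon>\<close> or positive for all small \<open>\<epsilon>\<close>.
\<close>

definition diophantine_dim :: "(real \<Rightarrow> 'a::metric_space) \<Rightarrow> ereal" where
  "diophantine_dim \<phi> =
    (if \<forall>\<^sub>F \<epsilon> in at_right 0. inclusion_length \<phi> \<epsilon> = 0
     then Limsup (at_right 0) (\<lambda>\<epsilon>. ereal (ln (inclusion_length \<phi> \<epsilon> + 1) / ln (1 / \<epsilon>)))
     else Limsup (at_right 0) (\<lambda>\<epsilon>. ereal (ln (inclusion_length \<phi> \<epsilon>) / ln (1 / \<epsilon>))))"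

end

(* Consider the lattice of vectors (q \<omega> - p, q) in R^(m+1), of covolume 1. The Diophantine condition
   says that the box |x| <= \<rho>, |y| <= Q with \<rho> ~ Q^(-(1+\<nu>)/m) meets it only in 0, so translates of
   a fixed fraction of this box, which has volume ~ Q^(-\<nu>), embed in the quotient torus and at most
   M ~ Q^\<nu> of them fit in disjointly. As the torus is connected, the dilation of the box by a
   multiple of M covers it: otherwise, along a path leaving all smaller dilations one could place
   too many disjoint boxes. Hence every x is within Q^(\<nu> - (1+\<nu>)/m) of some j \<omega> modulo Z^m
   with |j| ~ Q^(1+\<nu>), up to constants. Solving for Q bounds the gaps between the integers q with
   |q \<omega>| <= \<delta>, and these are almost periods by the Hoelder condition. *)
theory Submission
  imports Defs "HOL-Real_Asymp.Real_Asymp"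
begin

section \<open>Packing separated points into the torus\<close>

text \<open>Pigeonhole: cut the unit cube into \<open>N ^ DIM('a)\<close> cells of side
  \<open>1 / N\<close>. Modulo the lattice, two points of one cell differ by a vector of l1 norm at
  most \<open>DIM('a) / N\<close>, hence at most \<open>\<rho>\<close>, so separated points occupy
  different cells.\<close>

lemma lattice_packing:
  fixes f :: "'i \<Rightarrow> 'a::euclidean_space"
  assumes I: "finite I" and N: "N \<ge> 1" "real DIM('a) \<le> \<rho> * real N"
    and sep: "\<And>i j. i \<in> I \<Longrightarrow> j \<in> I \<Longrightarrow> i \<noteq> j \<Longrightarrow> lattice_dist (f i - f j) > \<rho>"
  shows "card I \<le> N ^ DIM('a)"
proof -
  define c where "c i = (\<lambda>b\<in>Basis. nat \<lfloor>real N * frac (f i \<bullet> b)\<rfloor>)" for i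
  have c: "c i \<in> Basis \<rightarrow>\<^sub>E {..<N}" for i
  proof -
    have "nat \<lfloor>real N * frac x\<rfloor> < N" for x
    proof -
      have "real N * frac x < real N * 1"
        using N frac_lt_1[of x] by (intro mult_strict_left_mono) auto
      then show ?thesis
        using N by (simp add: floor_less_iff nat_less_iff)
    qed
    then show ?thesis
      by (auto simp: c_def)
  qed
  have "inj_on c I"
  proof (rule inj_onI, rule ccontr)
    fix i j assume ij: "i \<in> I" "j \<in> I" "c i = c j" "i \<noteq> j"
    \<comment> \<open>Subtracting the integer parts leaves the difference of two points of the unit
      cube that lie in the same cell.\<close>
    define l where "l = (\<Sum>b\<in>Basis. (of_int (\<lfloor>f i \<bullet> b\<rfloor> - \<lfloor>f j \<bullet> b\<rfloor>) :: real) *\<^sub>R b :: 'a)"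
    have l: "l \<in> int_lattice"
      by (auto simp: int_lattice_def l_def)
    have "\<bar>(f i - f j - l) \<bullet> b\<bar> \<le> 1 / real N" if b: "b \<in> Basis" for b
    proof -
      define u v where "u = real N * frac (f i \<bullet> b)" and "v = real N * frac (f j \<bullet> b)"
      have "nat \<lfloor>u\<rfloor> = nat \<lfloor>v\<rfloor>"
        using fun_cong[OF ij(3), of b] b by (simp add: c_def u_def v_def)
      moreover have "u \<ge> 0" "v \<ge> 0"
        by (simp_all add: u_def v_def)
      ultimately have "\<lfloor>u\<rfloor> = \<lfloor>v\<rfloor>"
        by (simp add: eq_nat_nat_iff)
      then have "\<bar>u - v\<bar> \<le> 1"
        by linarith
      moreover have "l \<bullet> b = of_int (\<lfloor>f i \<bullet> b\<rfloor> - \<lfloor>f j \<bullet> b\<rfloor>)"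
        unfolding l_def using b by (rule inner_sum_left_Basis)
      then have "u - v = real N * ((f i - f j - l) \<bullet> b)"
        by (simp add: u_def v_def frac_def inner_diff_left right_diff_distrib)
      ultimately show ?thesis
        using N by (simp add: abs_mult field_simps)
    qed
    then have "norm (f i - f j - l) \<le> (\<Sum>b::'a\<in>Basis. 1 / real N)"
      by (intro order.trans[OF norm_le_l1] sum_mono) auto
    also have "\<dots> \<le> \<rho>"
      using N by (simp add: field_simps)
    finally have "lattice_dist (f i - f j) \<le> \<rho>"
      using lattice_dist_le[OF l, of "f i - f j"] by (simp add: dist_norm)
    then show False
      using sep[OF ij(1,2,4)] by simp
  qed
  then have "card I \<le> card (Basis \<rightarrow>\<^sub>E {..<N} :: ('a \<Rightarrow> nat) set)"
    using c by (intro card_inj_on_le[where f = c]) (auto intro: finite_PiE)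
  then show ?thesis
    by (simp add: card_PiE)
qed

section \<open>Covering the torus by a dilated box\<close>

text \<open>The image of the \<open>k\<close>-fold dilated box, sliced at integer heights.\<close>

definition orbit_nbhd :: "'a::euclidean_space \<Rightarrow> nat \<Rightarrow> real \<Rightarrow> nat \<Rightarrow> 'a set" where
  "orbit_nbhd \<omega> Q \<rho> k =
    {x. \<exists>j::int. \<bar>j\<bar> \<le> int (k * Q) \<and> lattice_dist (x - of_int j *\<^sub>R \<omega>) \<le> real k * \<rho>}"

text \<open>Heights add, and the lattice distances obey the triangle inequality.\<close>

lemma orbit_nbhd_add:
  assumes "x \<in> orbit_nbhd \<omega> Q \<rho> k" "y \<in> orbit_nbhd \<omega> Q \<rho> l"
  shows "x + y \<in> orbit_nbhd \<omega> Q \<rho> (k + l)"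
proof -
  obtain i j :: int where
    i: "\<bar>i\<bar> \<le> int (k * Q)" "lattice_dist (x - of_int i *\<^sub>R \<omega>) \<le> real k * \<rho>" and
    j: "\<bar>j\<bar> \<le> int (l * Q)" "lattice_dist (y - of_int j *\<^sub>R \<omega>) \<le> real l * \<rho>"
    using assms by (auto simp: orbit_nbhd_def)
  have "x + y - of_int (i + j) *\<^sub>R \<omega> = (x - of_int i *\<^sub>R \<omega>) + (y - of_int j *\<^sub>R \<omega>)"
    by (simp add: algebra_simps)
  then have "lattice_dist (x + y - of_int (i + j) *\<^sub>R \<omega>) \<le> real (k + l) * \<rho>"
    using lattice_dist_triangle[of "x - of_int i *\<^sub>R \<omega>" "y - of_int j *\<^sub>R \<omega>"] i j
    by (simp add: algebra_simps)
  moreover have "\<bar>i + j\<bar> \<le> int ((k + l) * Q)"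
    using i(1) j(1) by (simp add: algebra_simps)
  ultimately show ?thesis
    unfolding orbit_nbhd_def by blast
qed

lemma zero_in_orbit_nbhd:
  fixes \<omega> :: "'a::euclidean_space"
  shows "\<rho> \<ge> 0 \<Longrightarrow> 0 \<in> orbit_nbhd \<omega> Q \<rho> k"
  unfolding orbit_nbhd_def using lattice_dist_eq_0_iff[of "0::'a"] int_lattice_0
  by (auto intro!: exI[of _ 0])

lemma orbit_nbhd_mono:
  assumes "\<rho> \<ge> 0" "k \<le> l"
  shows "orbit_nbhd \<omega> Q \<rho> k \<subseteq> orbit_nbhd \<omega> Q \<rho> l"
  using orbit_nbhd_add[OF _ zero_in_orbit_nbhd[OF assms(1)], of _ \<omega> Q k "l - k"] assms(2) by auto

text \<open>A discrete form of connectedness: walk from 0 to \<open>x\<close> along a segment in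
  steps no longer than \<open>\<rho>\<close>. The walk starts inside dilate \<open>k\<close> and
  ends outside it; a single step lies in dilate 1 at height 0, so a step that leaves dilate
  \<open>k\<close> still lands in dilate \<open>k + 1\<close>.\<close>

lemma orbit_nbhd_boundary:
  fixes x :: "'a::euclidean_space"
  assumes \<rho>: "\<rho> > 0" and x: "x \<notin> orbit_nbhd \<omega> Q \<rho> k"
  obtains z where "z \<in> orbit_nbhd \<omega> Q \<rho> (k + 1)" "z \<notin> orbit_nbhd \<omega> Q \<rho> k"
proof -
  obtain n :: nat where n: "n \<ge> 1" "norm x \<le> real n * \<rho>"
  proof -
    obtain n :: nat where "norm x / \<rho> < real n"
      using reals_Archimedean2 by blast
    then show thesis
      using that[of "Suc n"] \<rho> by (simp add: field_simps)
  qed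
  define y where "y i = (real i / real n) *\<^sub>R x" for i :: nat
  have y0: "y 0 \<in> orbit_nbhd \<omega> Q \<rho> k"
    using zero_in_orbit_nbhd[of \<rho> \<omega> Q k] \<rho> by (simp add: y_def)
  have "\<exists>i. y i \<in> orbit_nbhd \<omega> Q \<rho> k \<and> y (Suc i) \<notin> orbit_nbhd \<omega> Q \<rho> k"
  proof (rule ccontr)
    assume "\<not> ?thesis"
    then have "y i \<in> orbit_nbhd \<omega> Q \<rho> k" for i
      by (induction i) (use y0 in auto)
    from this[of n] show False
      using x n by (simp add: y_def)
  qed
  then obtain i where i: "y i \<in> orbit_nbhd \<omega> Q \<rho> k" "y (Suc i) \<notin> orbit_nbhd \<omega> Q \<rho> k"
    by blast
  have "lattice_dist ((1 / real n) *\<^sub>R x) \<le> norm x / real n"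
    using lattice_dist_le[OF int_lattice_0, of "(1 / real n) *\<^sub>R x"] by simp
  also have "\<dots> \<le> \<rho>"
    using n by (simp add: field_simps)
  finally have "lattice_dist ((1 / real n) *\<^sub>R x) \<le> \<rho>" .
  then have "(1 / real n) *\<^sub>R x \<in> orbit_nbhd \<omega> Q \<rho> 1"
    unfolding orbit_nbhd_def by (auto intro!: exI[of _ 0])
  moreover have "y (Suc i) = y i + (1 / real n) *\<^sub>R x"
    by (simp add: y_def add_divide_distrib algebra_simps)
  ultimately have "y (Suc i) \<in> orbit_nbhd \<omega> Q \<rho> (k + 1)"
    using orbit_nbhd_add[OF i(1)] by metis
  then show thesis
    using i that by blast
qed

text \<open>If \<open>x\<close> lies outside dilate \<open>2 * M\<close>, every \<open>k < M\<close>
  yields a point \<open>z k\<close> in dilate \<open>2 * k + 1\<close> but not in dilate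
  \<open>2 * k\<close>. The \<open>M * (Q + 1)\<close> points \<open>z k + i * \<omega>\<close> with
  \<open>i \<le> Q\<close> are then separated by more than \<open>\<rho>\<close>, too many for the
  packing bound.\<close>

lemma orbit_nbhd_UNIV:
  fixes \<omega> :: "'a::euclidean_space"
  assumes \<rho>: "\<rho> > 0" and N: "N \<ge> 1" "real DIM('a) \<le> \<rho> * real N"
    and \<omega>: "\<And>q::nat. 1 \<le> q \<Longrightarrow> q \<le> Q \<Longrightarrow> lattice_dist (real q *\<^sub>R \<omega>) > \<rho>"
    and M: "N ^ DIM('a) < M * (Q + 1)"
  shows "x \<in> orbit_nbhd \<omega> Q \<rho> (2 * M)"
proof (rule ccontr)
  assume x: "x \<notin> orbit_nbhd \<omega> Q \<rho> (2 * M)"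
  have "\<exists>z. z \<in> orbit_nbhd \<omega> Q \<rho> (2 * k + 1) \<and> z \<notin> orbit_nbhd \<omega> Q \<rho> (2 * k)" if "k < M" for k
  proof -
    have "x \<notin> orbit_nbhd \<omega> Q \<rho> (2 * k)"
      using x orbit_nbhd_mono[of \<rho> "2 * k" "2 * M" \<omega> Q] \<rho> that by auto
    from orbit_nbhd_boundary[OF \<rho> this] show ?thesis
      by blast
  qed
  then obtain z where z: "\<And>k. k < M \<Longrightarrow> z k \<in> orbit_nbhd \<omega> Q \<rho> (2 * k + 1)"
      "\<And>k. k < M \<Longrightarrow> z k \<notin> orbit_nbhd \<omega> Q \<rho> (2 * k)"
    by metis
  \<comment> \<open>Disjointness of the boxes centred at the \<open>z k\<close> means that the points below are separated.\<close>
  define f where "f p = z (fst p) + real (snd p) *\<^sub>R \<omega>" for p :: "nat \<times> nat"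
  have diff: "f (k, i) - f (l, j) = z k - z l - of_int (int j - int i) *\<^sub>R \<omega>" for k i l j
    by (simp add: f_def algebra_simps)
  \<comment> \<open>The spacing 2 of the layers matters here: a close pair would put
    \<open>z k\<close> into dilate \<open>(2 * l + 1) + 1\<close>, which is contained in dilate
    \<open>2 * k\<close> because \<open>l < k\<close>.\<close>
  have less: "lattice_dist (f (k, i) - f (l, j)) > \<rho>"
    if "l < k" "k < M" "i \<le> Q" "j \<le> Q" for k l i j
  proof (rule ccontr)
    assume "\<not> ?thesis"
    then have "z k - z l \<in> orbit_nbhd \<omega> Q \<rho> 1"
      unfolding diff orbit_nbhd_def using that by (auto intro!: exI[of _ "int j - int i"])
    from orbit_nbhd_add[OF z(1) this, of l] that
    have "z k \<in> orbit_nbhd \<omega> Q \<rho> (2 * l + 2)"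
      by simp
    then show False
      using orbit_nbhd_mono[of \<rho> "2 * l + 2" "2 * k" \<omega> Q] \<rho> z(2)[of k] that by auto
  qed
  have eq: "lattice_dist (f (k, i) - f (k, j)) > \<rho>" if "j < i" "i \<le> Q" for k i j
    using \<omega>[of "i - j"] that by (simp add: f_def of_nat_diff algebra_simps)
  have comm: "lattice_dist (f p - f q) = lattice_dist (f q - f p)" for p q
    using lattice_dist_minus[of "f p - f q"] by simp
  have sep: "lattice_dist (f p - f q) > \<rho>"
    if pq: "p \<in> {..<M} \<times> {..Q}" "q \<in> {..<M} \<times> {..Q}" "p \<noteq> q" for p q
  proof -
    obtain k i l j where [simp]: "p = (k, i)" "q = (l, j)"
      by (metis surj_pair)
    consider "l < k" | "k < l" | "k = l" "j < i" | "k = l" "i < j"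
      using pq(3) by fastforce
    then show ?thesis
    proof cases
      case 1
      then show ?thesis using less[of l k i j] pq by simp
    next
      case 2
      then show ?thesis using less[of k l j i] pq comm[of p q] by simp
    next
      case 3
      then show ?thesis using eq[of j i k] pq by simp
    next
      case 4
      then show ?thesis using eq[of i j k] pq comm[of p q] by simp
    qed
  qed
  have "card ({..<M} \<times> {..Q}) \<le> N ^ DIM('a)"
    by (rule lattice_packing[OF _ N sep]) auto
  then show False
    using M by (simp add: card_cartesian_product)
qed

section \<open>Return times under the Diophantine condition\<close>

text \<open>With \<open>\<rho>\<close> of order \<open>Q^(-(1+\<nu>)/m)\<close> the packing bound is
  of order \<open>Q^(1+\<nu>)\<close>, so \<open>M\<close> of order \<open>Q^\<nu>\<close> suffices.
  Dilate \<open>2 * M\<close> then has height \<open>2 * M * Q\<close> and radius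
  \<open>2 * M * \<rho>\<close>, which are the two bounds.\<close>

lemma diophantine_orbit_covering:
  fixes \<omega> :: "real ^ 'm"
  assumes "diophantine \<nu> \<omega>" and \<nu>: "\<nu> \<ge> 0"
  obtains A where "A \<ge> 1"
    "\<And>(Q::nat) x. Q \<ge> 1 \<Longrightarrow> \<exists>j::int. \<bar>of_int j\<bar> \<le> A * real Q powr (1 + \<nu>) \<and>
       lattice_dist (x - of_int j *\<^sub>R \<omega>) \<le> A * real Q powr (\<nu> - (1 + \<nu>) / real CARD('m))"
proof -
  define m where "m = CARD('m)"
  define e where "e = (1 + \<nu>) / real m"
  have m: "m \<ge> 1"
    by (simp add: m_def Suc_leI)
  have e: "e \<ge> 0" "e * real m = 1 + \<nu>"
    using m \<nu> by (auto simp: e_def)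
  obtain C where C: "C > 0" "\<And>q::nat. q \<ge> 1 \<Longrightarrow> lattice_dist (real q *\<^sub>R \<omega>) \<ge> C * (1 / real q) powr e"
    using assms(1) unfolding diophantine_def e_def m_def by blast
  \<comment> \<open>\<open>c < C\<close> makes the separation strict; \<open>c \<le> 1\<close> gives
    \<open>\<rho> \<le> 1\<close>, so that \<open>real m / \<rho> \<ge> 1\<close> and rounding it up
    at most doubles it.\<close>
  define c where "c = min (C / 2) 1"
  have c: "c > 0" "c \<le> 1" "c < C"
    using C(1) by (auto simp: c_def min_def)
  define B where "B = (2 * real m / c) ^ m"
  have B: "B > 0"
    using m c by (simp add: B_def)
  show thesis
  proof (rule that[of "2 * (B + 1)"])
    show "2 * (B + 1) \<ge> 1"
      using B by simp
    fix Q :: nat and x :: "real ^ 'm"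
    assume Q: "Q \<ge> 1"
    define \<rho> where "\<rho> = c * real Q powr (- e)"
    have "real Q powr (- e) \<le> 1"
      using Q e powr_mono[of "- e" 0 "real Q"] by simp
    then have \<rho>: "\<rho> > 0" "\<rho> \<le> 1"
      using c Q mult_mono[of c 1 "real Q powr (- e)" 1] by (auto simp: \<rho>_def)
    have sep: "lattice_dist (real q *\<^sub>R \<omega>) > \<rho>" if q: "1 \<le> q" "q \<le> Q" for q :: nat
    proof -
      have "\<rho> < C * real Q powr (- e)"
        using c Q by (simp add: \<rho>_def)
      also have "\<dots> = C * (1 / real Q) powr e"
        using Q by (simp add: powr_minus powr_divide inverse_eq_divide)
      also have "\<dots> \<le> C * (1 / real q) powr e"
        using C(1) q e by (intro mult_left_mono powr_mono2) (auto simp: field_simps)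
      also have "\<dots> \<le> lattice_dist (real q *\<^sub>R \<omega>)"
        using C(2) q by simp
      finally show ?thesis .
    qed
    define N where "N = nat \<lceil>real m / \<rho>\<rceil>"
    have mr: "real m / \<rho> \<ge> 1"
      using m \<rho> by (simp add: field_simps)
    have N: "N \<ge> 1" "real m / \<rho> \<le> real N" "real N \<le> 2 * (real m / \<rho>)"
      using mr unfolding N_def by linarith+
    \<comment> \<open>The added 1 makes \<open>N ^ m < M * (Q + 1)\<close> strict; it is absorbed
      into the constant because \<open>real Q powr \<nu> \<ge> 1\<close>.\<close>
    define M where "M = nat \<lfloor>B * real Q powr \<nu>\<rfloor> + 1"
    have BQ: "B * real Q powr \<nu> \<ge> 0"
      using B by simp
    have M: "B * real Q powr \<nu> < real M" "real M \<le> B * real Q powr \<nu> + 1"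
      using BQ unfolding M_def by linarith+
    have "real Q powr \<nu> \<ge> 1"
      using Q \<nu> by (simp add: ge_one_powr_ge_zero)
    then have M': "real M \<le> (B + 1) * real Q powr \<nu>"
      using M(2) by (simp add: algebra_simps)
    have "real (N ^ m) \<le> (2 * (real m / \<rho>)) ^ m"
      using N(3) by (simp add: power_mono)
    also have "\<dots> = B * (real Q powr e) ^ m"
      by (simp add: \<rho>_def B_def powr_minus power_mult_distrib power_divide field_simps)
    also have "(real Q powr e) ^ m = real Q powr (1 + \<nu>)"
      using Q e(2) by (simp add: powr_powr flip: powr_realpow)
    also have "B * real Q powr (1 + \<nu>) = B * real Q powr \<nu> * real Q"
      using Q by (simp add: powr_add)
    also have "\<dots> < real M * real (Q + 1)"
      using M(1) BQ by (intro mult_strict_mono') auto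
    finally have "N ^ m < M * (Q + 1)"
      by (simp only: of_nat_less_iff flip: of_nat_mult)
    then have "x \<in> orbit_nbhd \<omega> Q \<rho> (2 * M)"
      using \<rho> N sep by (intro orbit_nbhd_UNIV[where N = N]) (auto simp: m_def field_simps)
    then obtain j :: int where j: "\<bar>j\<bar> \<le> int (2 * M * Q)"
        "lattice_dist (x - of_int j *\<^sub>R \<omega>) \<le> real (2 * M) * \<rho>"
      by (auto simp: orbit_nbhd_def)
    have "\<bar>real_of_int j\<bar> \<le> 2 * real M * real Q"
      using j(1) by (metis of_int_abs of_int_le_iff of_int_of_nat_eq of_nat_mult of_nat_numeral)
    also have "\<dots> \<le> 2 * ((B + 1) * real Q powr \<nu>) * real Q"
      using M' by (intro mult_mono) auto
    also have "\<dots> = 2 * (B + 1) * real Q powr (1 + \<nu>)"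
      using Q by (simp add: powr_add)
    finally have 1: "\<bar>real_of_int j\<bar> \<le> 2 * (B + 1) * real Q powr (1 + \<nu>)" .
    have "real (2 * M) * \<rho> \<le> 2 * ((B + 1) * real Q powr \<nu>) * (1 * real Q powr (- e))"
      unfolding \<rho>_def using M' c B by (intro mult_mono) auto
    also have "\<dots> = 2 * (B + 1) * real Q powr (\<nu> - e)"
      using Q by (simp add: powr_diff powr_minus field_simps)
    finally show "\<exists>j::int. \<bar>of_int j\<bar> \<le> 2 * (B + 1) * real Q powr (1 + \<nu>) \<and>
       lattice_dist (x - of_int j *\<^sub>R \<omega>)
         \<le> 2 * (B + 1) * real Q powr (\<nu> - (1 + \<nu>) / real CARD('m))"
      using 1 j(2) unfolding e_def m_def by (intro exI[of _ j]) auto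
  qed
qed

text \<open>The covering radius decays like \<open>Q powr (- \<beta>)\<close> with
  \<open>\<beta> = (1 + \<nu>) / m - \<nu>\<close>, and \<open>\<nu> * (m - 1) < 1\<close> says
  exactly that \<open>\<beta> > 0\<close>. Solving for \<open>Q\<close> turns the height
  \<open>Q powr (1 + \<nu>)\<close> into a constant times \<open>\<delta> powr (- D)\<close>, as
  \<open>D = (1 + \<nu>) / \<beta>\<close>.\<close>

lemma diophantine_return_times:
  fixes \<omega> :: "real ^ 'm"
  assumes dioph: "diophantine \<nu> \<omega>" and \<nu>: "\<nu> \<ge> 0" "\<nu> * (real CARD('m) - 1) < 1"
  defines "D \<equiv> (1 + \<nu>) * real CARD('m) / (1 - \<nu> * (real CARD('m) - 1))"
  obtains A where "A \<ge> 1"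
    "\<And>\<delta> x. 0 < \<delta> \<Longrightarrow> \<delta> \<le> 1 \<Longrightarrow> \<exists>j::int. \<bar>of_int j\<bar> \<le> A * \<delta> powr (- D) \<and>
       lattice_dist (x - of_int j *\<^sub>R \<omega>) \<le> \<delta>"
proof -
  define \<beta> where "\<beta> = (1 + \<nu>) / real CARD('m) - \<nu>"
  have \<beta>_eq: "\<beta> = (1 - \<nu> * (real CARD('m) - 1)) / real CARD('m)"
    by (simp add: \<beta>_def field_simps)
  then have \<beta>: "\<beta> > 0"
    using \<nu> by simp
  have D: "D = (1 + \<nu>) / \<beta>"
    by (simp add: D_def \<beta>_eq)
  obtain A where A: "A \<ge> 1"
    "\<And>(Q::nat) x. Q \<ge> 1 \<Longrightarrow> \<exists>j::int. \<bar>of_int j\<bar> \<le> A * real Q powr (1 + \<nu>) \<and>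
       lattice_dist (x - of_int j *\<^sub>R \<omega>) \<le> A * real Q powr (- \<beta>)"
    using diophantine_orbit_covering[OF dioph \<nu>(1)] unfolding \<beta>_def by (metis minus_diff_eq)
  \<comment> \<open>The factor \<open>2 powr (1 + \<nu>)\<close> pays for rounding \<open>s\<close>
    up to \<open>Q \<le> 2 * s\<close>, and \<open>A powr D\<close> for the \<open>A\<close> inside
    \<open>s\<close>.\<close>
  define A' where "A' = A * (2 powr (1 + \<nu>) * A powr D)"
  show thesis
  proof (rule that[of A'])
    have "2 powr (1 + \<nu>) \<ge> 1" "A powr D \<ge> 1"
      using A(1) \<nu>(1) \<beta> by (auto simp: D ge_one_powr_ge_zero)
    then have "1 * (1 * 1) \<le> A'"
      unfolding A'_def using A(1) by (intro mult_mono) auto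
    then show "A' \<ge> 1"
      by simp
    fix \<delta> :: real and x :: "real ^ 'm"
    assume \<delta>: "0 < \<delta>" "\<delta> \<le> 1"
    \<comment> \<open>The solution of \<open>A * s powr (- \<beta>) = \<delta>\<close>; rounding it
      up only shrinks the radius.\<close>
    define s where "s = (A / \<delta>) powr (1 / \<beta>)"
    have "A / \<delta> \<ge> 1"
      using A(1) \<delta> by (simp add: field_simps)
    then have s: "s \<ge> 1"
      using \<beta> by (simp add: s_def ge_one_powr_ge_zero)
    define Q where "Q = nat \<lceil>s\<rceil>"
    have Q: "Q \<ge> 1" "s \<le> real Q" "real Q \<le> 2 * s"
      using s unfolding Q_def by linarith+
    obtain j :: int where j: "\<bar>of_int j\<bar> \<le> A * real Q powr (1 + \<nu>)"
        "lattice_dist (x - of_int j *\<^sub>R \<omega>) \<le> A * real Q powr (- \<beta>)"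
      using A(2)[OF Q(1)] by blast
    have "A * real Q powr (1 + \<nu>) \<le> A * (2 * s) powr (1 + \<nu>)"
      using Q A(1) \<nu>(1) by (intro mult_left_mono powr_mono2) auto
    also have "\<dots> = A' * \<delta> powr (- D)"
      using s A(1) \<delta> \<beta>
      by (simp add: A'_def s_def D powr_mult powr_powr powr_divide powr_minus field_simps)
    finally have 1: "A * real Q powr (1 + \<nu>) \<le> A' * \<delta> powr (- D)" .
    have "A * real Q powr (- \<beta>) \<le> A * s powr (- \<beta>)"
      using Q A(1) s \<beta> by (intro mult_left_mono powr_mono2') auto
    also have "\<dots> = \<delta>"
      using A(1) \<delta> \<beta> by (simp add: s_def powr_powr powr_minus)
    finally show "\<exists>j::int. \<bar>of_int j\<bar> \<le> A' * \<delta> powr (- D) \<and>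
       lattice_dist (x - of_int j *\<^sub>R \<omega>) \<le> \<delta>"
      using 1 j by (intro exI[of _ j]) auto
  qed
qed

section \<open>From inclusion lengths to the Diophantine dimension\<close>

text \<open>After taking logarithms the constant contributes
  \<open>ln A / ln (1 / \<epsilon>)\<close>, which tends to 0, so only the exponent survives in the
  upper limit.\<close>

lemma diophantine_dim_le:
  fixes \<phi> :: "real \<Rightarrow> 'a::metric_space"
  assumes A: "A \<ge> 1" and E: "E \<ge> 0" and "\<epsilon>1 > 0"
    and L: "\<And>\<epsilon>. 0 < \<epsilon> \<Longrightarrow> \<epsilon> < \<epsilon>1 \<Longrightarrow>
      A * \<epsilon> powr (- E) \<in> inclusion_lengths (almost_periods \<epsilon> \<phi>)"
  shows "diophantine_dim \<phi> \<le> ereal E"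
proof -
  let ?l = "inclusion_length \<phi>"
  define g where "g \<epsilon> = ln A / ln (1 / \<epsilon>) + E" for \<epsilon>
  have "(g \<longlongrightarrow> E) (at_right 0)"
    unfolding g_def by real_asymp
  then have g: "Limsup (at_right 0) (\<lambda>\<epsilon>. ereal (g \<epsilon>)) = ereal E"
    by (intro lim_imp_Limsup) auto
  have small: "\<forall>\<^sub>F \<epsilon> in at_right 0. 0 < \<epsilon> \<and> \<epsilon> < min \<epsilon>1 (1::real)"
    using \<open>\<epsilon>1 > 0\<close> by (auto simp: eventually_at_right_field intro!: exI[of _ "min \<epsilon>1 1"])
  have g0: "0 \<le> g \<epsilon>" if "0 < \<epsilon>" "\<epsilon> < min \<epsilon>1 1" for \<epsilon>
    using that A E by (simp add: g_def)
  have le: "ln (?l \<epsilon>) / ln (1 / \<epsilon>) \<le> g \<epsilon>" if \<epsilon>: "0 < \<epsilon>" "\<epsilon> < min \<epsilon>1 1" for \<epsilon>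
  proof (cases "?l \<epsilon> = 0")
    \<comment> \<open>Here \<open>ln 0 = 0\<close> by convention, so nonnegativity of
      \<open>g\<close> suffices.\<close>
    case True
    then show ?thesis using g0[OF \<epsilon>] by simp
  next
    case False
    let ?S = "inclusion_lengths (almost_periods \<epsilon> \<phi>)"
    have S: "A * \<epsilon> powr (- E) \<in> ?S"
      using L \<epsilon> by simp
    have pos: "L \<ge> 0" if "L \<in> ?S" for L
      using that by (auto simp: inclusion_lengths_def)
    have "?l \<epsilon> \<le> A * \<epsilon> powr (- E)"
      unfolding inclusion_length_def using S pos by (intro cInf_lower bdd_belowI) auto
    moreover have "?l \<epsilon> > 0"
      using False S pos cInf_greatest[of ?S 0] unfolding inclusion_length_def by fastforce
    ultimately have "ln (?l \<epsilon>) \<le> ln (A * \<epsilon> powr (- E))"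
      by simp
    also have "\<dots> = ln A + E * ln (1 / \<epsilon>)"
      using A \<epsilon> by (simp add: ln_mult ln_powr ln_div)
    finally show ?thesis
      using \<epsilon> unfolding g_def by (simp add: field_simps)
  qed
  show ?thesis
  proof (cases "\<forall>\<^sub>F \<epsilon> in at_right 0. ?l \<epsilon> = 0")
    case True
    have "Limsup (at_right 0) (\<lambda>\<epsilon>. ereal (ln (?l \<epsilon> + 1) / ln (1 / \<epsilon>))) \<le>
        Limsup (at_right 0) (\<lambda>\<epsilon>. ereal (g \<epsilon>))"
      using True small by (intro Limsup_mono, eventually_elim) (use g0 in auto)
    then show ?thesis
      using True g by (simp add: diophantine_dim_def)
  next
    case False
    have "Limsup (at_right 0) (\<lambda>\<epsilon>. ereal (ln (?l \<epsilon>) / ln (1 / \<epsilon>))) \<le>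
        Limsup (at_right 0) (\<lambda>\<epsilon>. ereal (g \<epsilon>))"
      using small by (intro Limsup_mono, eventually_elim) (use le in auto)
    then show ?thesis
      using False g by (simp add: diophantine_dim_def)
  qed
qed

section \<open>Almost periods of the composed function\<close>

text \<open>A lattice point nearest to \<open>x\<close>, paired with \<open>q\<close>, is again a
  lattice point. Thus an integer shift of time costs nothing in the first coordinate of the
  torus.\<close>

lemma lattice_dist_Pair_of_int:
  fixes x :: "'a::euclidean_space"
  shows "lattice_dist (real_of_int q, x) \<le> lattice_dist x"
proof -
  obtain l where l: "l \<in> int_lattice" "lattice_dist x = dist x l"
    by (rule lattice_dist_attained)
  have "(real_of_int q, l) \<in> int_lattice"
    using l(1) by (auto simp: int_lattice_def Basis_prod_def)
  from lattice_dist_le[OF this, of "(real_of_int q, x)"] l show ?thesis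
    by (simp add: dist_Pair_Pair)
qed

lemma inclusion_lengths_mono:
  assumes "S \<subseteq> T"
  shows "inclusion_lengths S \<subseteq> inclusion_lengths T"
  using assms by (fastforce simp: inclusion_lengths_def)

lemma almost_periods_mono: "\<epsilon> \<le> \<epsilon>' \<Longrightarrow> almost_periods \<epsilon> \<phi> \<subseteq> almost_periods \<epsilon>' \<phi>"
  by (auto simp: almost_periods_def intro: order.trans)

lemma local_holder_continuous:
  assumes "local_holder \<alpha> f" "\<alpha> > 0"
  shows "continuous_on UNIV f"
proof -
  obtain C r where C: "C > 0" "r > 0"
    "\<And>y1 y2. dist y1 y2 < r \<Longrightarrow> dist (f y1) (f y2) \<le> C * dist y1 y2 powr \<alpha>"
    using assms(1) unfolding local_holder_def by blast
  have "(f \<longlongrightarrow> f x) (at x)" for x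
  proof (rule metric_tendsto_imp_tendsto)
    have "((\<lambda>y. C * dist y x powr \<alpha>) \<longlongrightarrow> C * dist x x powr \<alpha>) (at x)"
      using assms(2) by (intro tendsto_intros) auto
    then show "((\<lambda>y. C * dist y x powr \<alpha>) \<longlongrightarrow> 0) (at x)"
      by simp
    have "\<forall>\<^sub>F y in at x. dist y x < r"
      using C(2) by (auto simp: eventually_at)
    then show "\<forall>\<^sub>F y in at x. dist (f y) (f x) \<le> dist (C * dist y x powr \<alpha>) 0"
      by eventually_elim (use C(1,3) in fastforce)
  qed
  then show ?thesis
    by (simp add: continuous_on_def)
qed

lemma continuous_to_torus: "continuous_on UNIV to_torus"
proof -
  have "dist (to_torus x) (to_torus y) \<le> dist x y" for x y :: 'a
    using lattice_dist_le[OF int_lattice_0, of "x - y"]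
    by (simp add: dist_torus.abs_eq dist_norm)
  then show ?thesis
    unfolding continuous_on_iff by (meson le_less_trans)
qed

theorem theorem6:
  fixes \<Phi> :: "(real \<times> (real ^ 'm)) torus \<Rightarrow> 'x::complete_space"
    and \<omega> :: "real ^ 'm"
    and \<alpha> \<nu> :: real
    and \<phi> :: "real \<Rightarrow> 'x"
  assumes "0 < \<alpha>" and "\<alpha> \<le> 1"
    and "local_holder \<alpha> \<Phi>"
    and "\<nu> \<ge> 0" and "\<nu> * (real CARD('m) - 1) < 1"
    and "diophantine \<nu> \<omega>"
    and "\<And>t. \<phi> t = \<Phi> (to_torus (t, t *\<^sub>R \<omega>))"
  shows "almost_periodic \<phi> \<and>
    diophantine_dim \<phi>
      \<le> ereal (1 / \<alpha> * ((1 + \<nu>) * real CARD('m) / (1 - \<nu> * (real CARD('m) - 1))))"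
proof -
  define D where "D = (1 + \<nu>) * real CARD('m) / (1 - \<nu> * (real CARD('m) - 1))"
  have D: "D \<ge> 0"
    using assms(4,5) by (simp add: D_def)
  obtain C r where C: "C > 0" "r > 0"
    "\<And>y1 y2. dist y1 y2 < r \<Longrightarrow> dist (\<Phi> y1) (\<Phi> y2) \<le> C * dist y1 y2 powr \<alpha>"
    using assms(3) unfolding local_holder_def by blast
  obtain A where A: "A \<ge> 1"
    "\<And>\<delta> x. 0 < \<delta> \<Longrightarrow> \<delta> \<le> 1 \<Longrightarrow> \<exists>j::int. \<bar>of_int j\<bar> \<le> A * \<delta> powr (- D) \<and>
       lattice_dist (x - of_int j *\<^sub>R \<omega>) \<le> \<delta>"
    using diophantine_return_times[OF assms(6,4,5)] unfolding D_def by metis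
  \<comment> \<open>The shift by \<open>q\<close> translates the whole orbit on the torus by one
    vector of length at most \<open>\<delta>\<close>, so the Hoelder bound is uniform in
    \<open>t\<close>.\<close>
  have period: "of_int q \<in> almost_periods (C * \<delta> powr \<alpha>) \<phi>"
    if q: "lattice_dist (of_int q *\<^sub>R \<omega>) \<le> \<delta>" "\<delta> < r" for q :: int and \<delta>
  proof -
    have "dist (\<phi> (t + of_int q)) (\<phi> t) \<le> C * \<delta> powr \<alpha>" for t
    proof -
      let ?x = "to_torus (t + of_int q, (t + of_int q) *\<^sub>R \<omega>)" and ?y = "to_torus (t, t *\<^sub>R \<omega>)"
      have "dist ?x ?y = lattice_dist (real_of_int q, of_int q *\<^sub>R \<omega>)"
        by (simp add: dist_torus.abs_eq algebra_simps)
      then have le: "dist ?x ?y \<le> \<delta>"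
        using lattice_dist_Pair_of_int[of q "of_int q *\<^sub>R \<omega>"] q by simp
      then have "dist (\<Phi> ?x) (\<Phi> ?y) \<le> C * dist ?x ?y powr \<alpha>"
        using q by (intro C) auto
      also have "\<dots> \<le> C * \<delta> powr \<alpha>"
        using C le assms(1) by (intro mult_left_mono powr_mono2) auto
      finally show ?thesis
        by (simp add: assms(7))
    qed
    then show ?thesis
      by (auto simp: almost_periods_def intro!: SUP_least)
  qed
  define E where "E = D / \<alpha>"
  define K where "K = (1 / C) powr (- E)"
  \<comment> \<open>Below this threshold the solution of
    \<open>C * \<delta> powr \<alpha> = \<epsilon>\<close> satisfies \<open>\<delta> \<le> 1\<close>
    and, thanks to the half, lies strictly below the Hoelder radius \<open>r\<close>.\<close>
  define \<epsilon>1 where "\<epsilon>1 = C * min 1 (r / 2) powr \<alpha>"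
  \<comment> \<open>The maximum with 1 supplies the hypothesis \<open>A \<ge> 1\<close> of
    \<open>diophantine_dim_le\<close>.\<close>
  define A' where "A' = max 1 (4 * A * K)"
  have \<epsilon>1: "\<epsilon>1 > 0"
    using C by (simp add: \<epsilon>1_def)
  have L: "A' * \<epsilon> powr (- E) \<in> inclusion_lengths (almost_periods \<epsilon> \<phi>)"
    if \<epsilon>: "0 < \<epsilon>" "\<epsilon> < \<epsilon>1" for \<epsilon>
  proof -
    define \<delta> where "\<delta> = (\<epsilon> / C) powr (1 / \<alpha>)"
    have "\<delta> \<le> (min 1 (r / 2) powr \<alpha>) powr (1 / \<alpha>)"
      unfolding \<delta>_def using \<epsilon> C assms(1)
      by (intro powr_mono2) (auto simp: \<epsilon>1_def field_simps)
    also have "\<dots> = min 1 (r / 2)"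
      using C assms(1) by (simp add: powr_powr)
    finally have \<delta>: "0 < \<delta>" "\<delta> \<le> 1" "\<delta> < r"
      using C \<epsilon> by (auto simp: \<delta>_def)
    have C\<delta>: "C * \<delta> powr \<alpha> = \<epsilon>"
      using C \<epsilon> assms(1) by (simp add: \<delta>_def powr_powr)
    define J where "J = A * \<delta> powr (- D)"
    have "\<delta> powr (- D) \<ge> 1"
      using powr_mono'[of "- D" 0 \<delta>] \<delta> D by simp
    then have J: "J \<ge> 1"
      using mult_mono[of 1 A 1 "\<delta> powr (- D)"] A(1) by (simp add: J_def)
    have "\<delta> powr (- D) = (\<epsilon> * (1 / C)) powr (- E)"
      using C \<epsilon> by (simp add: \<delta>_def E_def powr_powr)
    also have "\<dots> = K * \<epsilon> powr (- E)"
      using C \<epsilon> by (subst powr_mult) (auto simp: K_def)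
    finally have "4 * J = 4 * A * K * \<epsilon> powr (- E)"
      by (simp add: J_def)
    also have "\<dots> \<le> A' * \<epsilon> powr (- E)"
      by (intro mult_right_mono) (auto simp: A'_def)
    finally have JL: "4 * J \<le> A' * \<epsilon> powr (- E)" .
    have "{a..a + A' * \<epsilon> powr (- E)} \<inter> almost_periods \<epsilon> \<phi> \<noteq> {}" for a
    proof -
      \<comment> \<open>The covering is applied to the point \<open>n * \<omega>\<close>, which
        makes \<open>n - j\<close> a return time. It lies between \<open>a\<close> and
        \<open>a + 2 * J + 1\<close>, within the interval of length at least \<open>4 * J\<close>
        because \<open>J \<ge> 1\<close>.\<close>
      define n where "n = \<lceil>a + J\<rceil>"
      obtain j :: int where j: "\<bar>of_int j\<bar> \<le> J"
          "lattice_dist (of_int n *\<^sub>R \<omega> - of_int j *\<^sub>R \<omega>) \<le> \<delta>"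
        using A(2)[OF \<delta>(1,2)] unfolding J_def by blast
      have "a + J \<le> of_int n" "of_int n < a + J + 1"
        unfolding n_def by linarith+
      then have "real_of_int (n - j) \<in> {a..a + A' * \<epsilon> powr (- E)}"
        using j(1) J JL by auto
      moreover have "real_of_int (n - j) \<in> almost_periods \<epsilon> \<phi>"
        using period[of "n - j" \<delta>] j(2) \<delta>(3) by (simp add: C\<delta> scaleR_diff_left)
      ultimately show ?thesis
        by blast
    qed
    then show ?thesis
      using J JL by (simp add: inclusion_lengths_def)
  qed
  have "almost_periodic \<phi>"
    unfolding almost_periodic_def
  proof (intro conjI allI impI)
    have "\<phi> = \<Phi> \<circ> to_torus \<circ> (\<lambda>t. (t, t *\<^sub>R \<omega>))"
      by (auto simp: assms(7))
    moreover have "continuous_on UNIV (\<Phi> \<circ> to_torus \<circ> (\<lambda>t. (t, t *\<^sub>R \<omega>)))"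
      using local_holder_continuous[OF assms(3,1)] continuous_to_torus
      by (intro continuous_on_compose continuous_intros) (auto intro: continuous_on_subset)
    ultimately show "continuous_on UNIV \<phi>"
      by simp
    \<comment> \<open>The bound \<open>L\<close> holds only below \<open>\<epsilon>1\<close>; for
      larger \<open>\<epsilon>\<close> the almost periods of a smaller tolerance serve.\<close>
    fix \<epsilon> :: real assume "\<epsilon> > 0"
    then have "A' * min \<epsilon> (\<epsilon>1 / 2) powr (- E)
        \<in> inclusion_lengths (almost_periods (min \<epsilon> (\<epsilon>1 / 2)) \<phi>)"
      using \<epsilon>1 by (intro L) auto
    then show "inclusion_lengths (almost_periods \<epsilon> \<phi>) \<noteq> {}"
      using inclusion_lengths_mono[OF almost_periods_mono[of "min \<epsilon> (\<epsilon>1 / 2)" \<epsilon> \<phi>]] by auto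
  qed
  moreover have "diophantine_dim \<phi> \<le> ereal E"
    using L \<epsilon>1 D assms(1) by (intro diophantine_dim_le[of A']) (auto simp: A'_def E_def)
  moreover have "E = 1 / \<alpha> * D"
    by (simp add: E_def)
  ultimately show ?thesis
    unfolding D_def by metis
qed

end
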